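(* Let $\Lambda$ be a lattice of determinant $1$ in $\mathbb R^n$, let $k$ be a natural number (with $k\ge 2$ if $n=1$), and let $V$ be the set of $k$-free points of $\Lambda$. For any two disjoint finite subsets $\mathcal P$ and $\mathcal Q$ of $\Lambda$, the set $$L(V;\mathcal P,\mathcal Q)=\{t\in\Lambda: \mathcal P+t\subset V,\ \mathcal Q+t\subset\Lambda\setminus V\}$$ has a well defined density, given by $$\sum_{\mathcal F\subset\mathcal Q}(-1)^{|\mathcal F|}\prod_p\left(1-\frac{|(\mathcal P\cup\mathcal F)/p^k\Lambda|}{p^{nk}}\right),$$ where the product is over all primes $p$.
   Context: For a nonzero $l\in\Lambda$, the $k$-content $c_k(l)$ is the largest integer $c$ such that $l\in c^k\Lambda$; $c_k(0)=\infty$. $V=\{l\in\Lambda:c_k(l)=1\}$. For a finite $\mathcal F\subset\Lambda$ and $m\in\mathbb N$, $\mathcal F/m\Lambda$ denotes the set of cosets of $m\Lambda$ in $\Lambda$ that are represented in $\mathcal F$. The density of $Y\subset\Lambda$ is $\delta(Y):=\lim_{R\to\infty}|Y\cap B_R(0)|/(R^nv_n)$ when the limit exists, where $B_R(0)$ is the open Euclidean ball and $v_n$ the volume of the unit ball in $\mathbb R^n$. *)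

theory Defs
  imports "HOL-Analysis.Analysis" "HOL-Computational_Algebra.Primes" "HOL-Library.Extended_Nat"
begin

text \<open>The columns of the matrix form an integral basis of the lattice.\<close>

definition lattice_basis :: "real^'n^'n \<Rightarrow> (real^'n) set \<Rightarrow> bool" where
  "lattice_basis A \<Lambda> \<longleftrightarrow> invertible A \<and> \<Lambda> = (*v) A ` {z. \<forall>i. z $ i \<in> \<int>}"

definition is_lattice :: "(real^'n) set \<Rightarrow> bool" where
  "is_lattice \<Lambda> \<longleftrightarrow> (\<exists>A. lattice_basis A \<Lambda>)"

text \<open>The value does not depend on the basis chosen; see \<open>lattice_det_eq\<close> below.\<close>

definition lattice_det :: "(real^'n) set \<Rightarrow> real" where
  "lattice_det \<Lambda> = \<bar>det (SOME A. lattice_basis A \<Lambda>)\<bar>"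

definition dilate :: "nat \<Rightarrow> (real^'n) set \<Rightarrow> (real^'n) set" where
  "dilate m \<Lambda> = (*\<^sub>R) (real m) ` \<Lambda>"

text \<open>
  For \<open>l \<in> \<Lambda>\<close> the number \<open>c = 1\<close> always satisfies the condition, so the largest such integer is
  positive and it is enough to range over the natural numbers. The maximum exists when
  \<open>\<Lambda>\<close> is a lattice, \<open>l \<in> \<Lambda>\<close>, \<open>l \<noteq> 0\<close> and \<open>k \<ge> 1\<close>.
\<close>

definition k_content :: "(real^'n) set \<Rightarrow> nat \<Rightarrow> real^'n \<Rightarrow> enat" where
  "k_content \<Lambda> k l = (if l = 0 then \<infinity> else enat (GREATEST c. l \<in> dilate (c ^ k) \<Lambda>))"

definition k_free_points :: "(real^'n) set \<Rightarrow> nat \<Rightarrow> (real^'n) set" where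
  "k_free_points \<Lambda> k = {l \<in> \<Lambda>. k_content \<Lambda> k l = 1}"

definition cosets_of :: "(real^'n) set \<Rightarrow> nat \<Rightarrow> (real^'n) set \<Rightarrow> (real^'n) set set" where
  "cosets_of F m \<Lambda> = (\<lambda>x. (+) x ` dilate m \<Lambda>) ` F"

definition locator_set ::
  "(real^'n) set \<Rightarrow> (real^'n) set \<Rightarrow> (real^'n) set \<Rightarrow> (real^'n) set \<Rightarrow> (real^'n) set" where
  "locator_set \<Lambda> V P Q = {t \<in> \<Lambda>. (\<lambda>x. x + t) ` P \<subseteq> V \<and> (\<lambda>x. x + t) ` Q \<subseteq> \<Lambda> - V}"

definition has_density :: "(real^'n) set \<Rightarrow> real \<Rightarrow> bool" where
  "has_density Y d \<longleftrightarrow>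
     ((\<lambda>R. real (card (Y \<inter> ball 0 R)) / (R ^ CARD('n) * measure lborel (ball (0 :: real^'n) 1)))
       \<longlongrightarrow> d) at_top"

text \<open>
  The factor at \<open>p\<close> of the product over primes. It is \<open>1\<close> at non-primes, so that the product over all
  primes is the library's infinite product over all natural numbers. Single factors may vanish,
  namely when \<open>F\<close> meets every coset of \<open>p\<^sup>k\<Lambda>\<close>.
\<close>

definition euler_factor :: "(real^'n) set \<Rightarrow> nat \<Rightarrow> (real^'n) set \<Rightarrow> nat \<Rightarrow> real" where
  "euler_factor \<Lambda> k F p =
     (if prime p then 1 - real (card (cosets_of F (p ^ k) \<Lambda>)) / real p ^ (CARD('n) * k) else 1)"

lemma integral_change_of_basis:
  fixes A B :: "real^'n^'n"
  assumes "lattice_basis A \<Lambda>" "lattice_basis B \<Lambda>"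
  obtains U where "A = B ** U" "det U \<in> \<int>"
proof -
  have "\<exists>z. (\<forall>i. z $ i \<in> \<int>) \<and> column j A = B *v z" for j
  proof -
    have "column j A = A *v axis j 1"
      by (simp add: matrix_vector_mult_basis)
    moreover have "\<forall>i. (axis j 1 :: real^'n) $ i \<in> \<int>"
      by (simp add: axis_def)
    ultimately have "column j A \<in> \<Lambda>"
      using assms(1) by (auto simp: lattice_basis_def)
    then show ?thesis
      using assms(2) by (auto simp: lattice_basis_def)
  qed
  then obtain z where z: "\<And>i j. z j $ i \<in> \<int>" "\<And>j. column j A = B *v z j"
    by metis
  define U :: "real^'n^'n" where "U = (\<chi> i j. z j $ i)"
  have "A $ i $ j = (B ** U) $ i $ j" for i j
  proof -
    have "A $ i $ j = column j A $ i" by (simp add: column_def)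
    also have "\<dots> = (B ** U) $ i $ j"
      by (simp add: z(2) U_def matrix_vector_mult_def matrix_matrix_mult_def)
    finally show ?thesis .
  qed
  then have "A = B ** U" by (simp add: vec_eq_iff)
  moreover have "det U \<in> \<int>"
    unfolding det_def U_def by (auto intro!: Ints_sum Ints_mult Ints_prod z)
  ultimately show thesis by (rule that)
qed

lemma lattice_basis_det_le:
  fixes A B :: "real^'n^'n"
  assumes "lattice_basis A \<Lambda>" "lattice_basis B \<Lambda>"
  shows "\<bar>det B\<bar> \<le> \<bar>det A\<bar>"
proof -
  obtain U where U: "A = B ** U" "det U \<in> \<int>"
    using integral_change_of_basis assms by blast
  have "det A \<noteq> 0"
    using assms(1) by (simp add: lattice_basis_def invertible_det_nz)
  then have "det U \<noteq> 0"
    by (auto simp: U(1) det_mul)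
  with U(2) have "1 \<le> \<bar>det U\<bar>"
    by (rule Ints_nonzero_abs_ge1)
  then show ?thesis
    using mult_left_mono[of 1 "\<bar>det U\<bar>" "\<bar>det B\<bar>"] by (simp add: U(1) det_mul abs_mult)
qed

lemma lattice_det_eq:
  assumes "lattice_basis A \<Lambda>"
  shows "lattice_det \<Lambda> = \<bar>det A\<bar>"
proof -
  have "lattice_basis (SOME A. lattice_basis A \<Lambda>) \<Lambda>"
    using assms by (rule someI)
  with assms show ?thesis
    unfolding lattice_det_def by (meson antisym lattice_basis_det_le)
qed

end

theory Submission
  imports Defs
begin

text \<open>
  Removing only the multiples of \<open>p\<^sup>k\<close> for \<open>p \<le> N\<close> leaves a finite union of cosets of a sublattice, whose
  density is the partial Euler product by the Chinese remainder theorem. The error made by this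
  truncation consists of points \<open>t\<close> for which some \<open>x + t\<close> with \<open>x \<in> P\<close> is zero or a nonzero element of
  \<open>m\<^sup>k\<Lambda>\<close> with \<open>m > N\<close>. There are at most \<open>C R\<^sup>n \<Sum>\<^sub>m m\<^sup>-\<^sup>n\<^sup>k\<close> points of the second kind in a ball of
  radius \<open>R\<close>, and \<open>n k \<ge> 2\<close> makes the sum over \<open>m > N\<close> tend to zero. This settles the case
  \<open>Q = {}\<close>; the general case follows by inclusion-exclusion, adding one point to \<open>Q\<close> at a time.
\<close>

section \<open>Lattice points in balls\<close>

text \<open>The library has this only for index types of class \<open>wellorder\<close>. Finiteness suffices, because
  a shear is a row operation on the identity, so its determinant needs no triangular shape.\<close>

lemma measure_matrix_image_aux:
  fixes A :: "real^'n^'n"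
  shows "\<forall>S\<in>lmeasurable. (*v) A ` S \<in> lmeasurable
    \<and> measure lebesgue ((*v) A ` S) = \<bar>det A\<bar> * measure lebesgue S"
proof (induction A rule: induct_matrix_elementary_alt)
  case (1 A B)
  have "(*v) (A ** B) ` S = (*v) A ` (*v) B ` S" for S
    by (simp add: matrix_vector_mult_matrix_matrix_mult_compose image_comp)
  with 1 show ?case by (simp add: det_mul abs_mult)
next
  case (2 A i)
  then have det: "det A = 0" by (rule det_zero_row)
  then have "\<not> inj ((*v) A)"
    by (metis inj_matrix_vector_mult invertible_det_nz matrix_left_invertible_injective
        invertible_left_inverse)
  then have "negligible ((*v) A ` S)" for S
    by (intro negligible_linear_singular_image) auto
  then show ?case
    by (simp add: det negligible_iff_measure)
next
  case (3 A)
  have "(*v) A = (\<lambda>x. \<chi> k. A $ k $ k * x $ k)"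
  proof
    fix x
    have "(\<Sum>j\<in>UNIV. A $ i $ j * x $ j) = A $ i $ i * x $ i" for i
      using 3 by (simp add: sum.remove[of _ i])
    then show "A *v x = (\<chi> k. A $ k $ k * x $ k)"
      by (simp add: matrix_vector_mult_def)
  qed
  then show ?case
    using 3 by (simp add: measurable_stretch measure_stretch det_diagonal)
next
  case (4 m n)
  let ?B = "(\<chi> i j. mat 1 $ i $ Transposition.transpose m n j) :: real^'n^'n"
  let ?\<tau> = "Transposition.transpose m n"
  have det: "\<bar>det ?B\<bar> = 1"
    by (simp add: det_permute_columns permutes_swap_id sign_swap_id abs_mult)
  have B: "?B *v x = (\<chi> i. x $ ?\<tau> i)" for x
  proof -
    have "(\<Sum>j\<in>UNIV. mat 1 $ i $ ?\<tau> j * x $ j) = x $ ?\<tau> i" for i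
    proof -
      have "(mat 1 :: real^'n^'n) $ i $ ?\<tau> j = of_bool (j = ?\<tau> i)" for j
        by (auto simp: mat_def)
      then show ?thesis by (simp only: sum.remove[OF finite UNIV_I, of _ "?\<tau> i"]) simp
    qed
    then show ?thesis by (simp add: matrix_vector_mult_def)
  qed
  \<comment> \<open>\<open>measure_linear_sufficient\<close> extends a volume factor from boxes to
    all measurable sets, so boxes suffice. The swap is an involution, hence it maps a box onto the
    box with two sides exchanged, which has the same volume.\<close>
  have box: "measure lebesgue ((*v) ?B ` cbox a b) = 1 * measure lebesgue (cbox a b)" for a b
  proof (cases "cbox a b = {}")
    case False
    have mem: "?B *v x \<in> cbox (?B *v a) (?B *v b) \<longleftrightarrow> x \<in> cbox a b" for x
      unfolding B by (auto simp: mem_box_cart) (metis transpose_involutory)+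
    have inv: "?B *v (?B *v x) = x" for x
      unfolding B by (simp add: vec_eq_iff)
    have eq: "(*v) ?B ` cbox a b = cbox (?B *v a) (?B *v b)"
      using mem inv by (metis (no_types, lifting) image_eqI subsetI subset_antisym image_subsetI)
    then have "cbox (?B *v a) (?B *v b) \<noteq> {}" using False by blast
    then have "measure lborel (cbox (?B *v a) (?B *v b)) = (\<Prod>i\<in>UNIV. b $ ?\<tau> i - a $ ?\<tau> i)"
      unfolding B by (simp add: content_cbox_cart)
    also have "\<dots> = (\<Prod>i\<in>UNIV. b $ i - a $ i)"
      by (rule prod.reindex_bij_betw) simp
    also have "\<dots> = measure lborel (cbox a b)" using False by (simp add: content_cbox_cart)
    finally show ?thesis by (simp add: eq)
  qed simp
  show ?case
  proof
    fix S :: "(real^'n) set"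
    assume "S \<in> lmeasurable"
    with matrix_vector_mul_linear
    have "(*v) ?B ` S \<in> lmeasurable \<and> 1 * measure lebesgue S = measure lebesgue ((*v) ?B ` S)"
      using box by (rule measure_linear_sufficient)
    then show "(*v) ?B ` S \<in> lmeasurable
        \<and> measure lebesgue ((*v) ?B ` S) = \<bar>det ?B\<bar> * measure lebesgue S"
      by (simp only: det abs_one mult_1)
  qed
next
  case (5 m n)
  let ?B = "(\<chi> i j. of_bool (i = m \<and> j = n \<or> i = j)) :: real^'n^'n"
  have "?B = (\<chi> k. if k = m then row m (mat 1) + 1 *s row n (mat 1) else row k (mat 1))"
    using 5 by (auto simp: vec_eq_iff row_def mat_def)
  then have det: "det ?B = 1" using det_row_operation[OF 5, of "mat 1" 1] by simp
  have B: "?B *v x = (\<chi> i. if i = m then x $ m + x $ n else x $ i)" for x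
  proof -
    have "(\<Sum>j\<in>UNIV. of_bool (i = m \<and> j = n \<or> i = j) * x $ j)
      = (if i = m then x $ m + x $ n else x $ i)" for i
    proof (cases "i = m")
      case True
      then show ?thesis
        using 5 by (subst sum.remove[of _ m]) (auto simp: sum.remove[of _ n] intro!: sum.neutral)
    qed (auto simp: sum.remove[of _ i])
    then show ?thesis by (simp add: matrix_vector_mult_def)
  qed
  have box: "measure lebesgue ((*v) ?B ` cbox a b) = 1 * measure lebesgue (cbox a b)" for a b
  proof (cases "cbox a b = {}")
    case False
    \<comment> \<open>\<open>measure_shear_interval\<close> wants a nonnegative lower bound in
      coordinate \<open>n\<close>. Translating by \<open>w\<close> moves that bound to 0, and by
      linearity the sheared image is merely translated too.\<close>
    define w :: "real^'n" where "w = (\<chi> i. if i = n then - a $ n else 0)"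
    have "cbox (w + a) (w + b) \<noteq> {}" using False by (simp add: cbox_translation)
    then have "measure lebesgue ((*v) ?B ` cbox (w + a) (w + b)) = measure lebesgue (cbox (w + a) (w + b))"
      unfolding B by (rule measure_shear_interval[OF 5]) (simp add: w_def)
    moreover have "(*v) ?B ` cbox (w + a) (w + b) = (+) (?B *v w) ` (*v) ?B ` cbox a b"
      unfolding cbox_translation image_image matrix_vector_right_distrib ..
    ultimately show ?thesis by (simp only: cbox_translation measure_translation mult_1)
  qed simp
  show ?case
  proof
    fix S :: "(real^'n) set"
    assume "S \<in> lmeasurable"
    with matrix_vector_mul_linear
    have "(*v) ?B ` S \<in> lmeasurable \<and> 1 * measure lebesgue S = measure lebesgue ((*v) ?B ` S)"
      using box by (rule measure_linear_sufficient)
    then show "(*v) ?B ` S \<in> lmeasurable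
        \<and> measure lebesgue ((*v) ?B ` S) = \<bar>det ?B\<bar> * measure lebesgue S"
      by (simp only: det abs_one mult_1)
  qed
qed

lemma
  fixes A :: "real^'n^'n"
  assumes "S \<in> lmeasurable"
  shows measurable_matrix_image: "(*v) A ` S \<in> lmeasurable"
    and measure_matrix_image: "measure lebesgue ((*v) A ` S) = \<bar>det A\<bar> * measure lebesgue S"
  using measure_matrix_image_aux[of A] assms by auto

section \<open>Lattices as additive groups, and their dilates\<close>

lemma
  assumes "lattice_basis A \<Lambda>"
  shows lattice_basis_zero: "0 \<in> \<Lambda>"
    and lattice_basis_add: "\<And>x y. x \<in> \<Lambda> \<Longrightarrow> y \<in> \<Lambda> \<Longrightarrow> x + y \<in> \<Lambda>"
    and lattice_basis_diff: "\<And>x y. x \<in> \<Lambda> \<Longrightarrow> y \<in> \<Lambda> \<Longrightarrow> x - y \<in> \<Lambda>"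
    and lattice_basis_scale: "\<And>x c. x \<in> \<Lambda> \<Longrightarrow> c \<in> \<int> \<Longrightarrow> c *\<^sub>R x \<in> \<Lambda>"
proof -
  have \<Lambda>: "\<Lambda> = (*v) A ` {z. \<forall>i. z $ i \<in> \<int>}"
    using assms by (simp add: lattice_basis_def)
  show "0 \<in> \<Lambda>"
    unfolding \<Lambda> by (rule image_eqI[where x=0]) auto
  show "x + y \<in> \<Lambda>" if xy: "x \<in> \<Lambda>" "y \<in> \<Lambda>" for x y
  proof -
    obtain u v where "x = A *v u" "y = A *v v" "\<forall>i. u $ i \<in> \<int>" "\<forall>i. v $ i \<in> \<int>"
      using xy unfolding \<Lambda> by auto
    then show ?thesis
      unfolding \<Lambda> by (intro image_eqI[where x="u+v"]) (auto simp: matrix_vector_right_distrib)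
  qed
  show "x - y \<in> \<Lambda>" if xy: "x \<in> \<Lambda>" "y \<in> \<Lambda>" for x y
  proof -
    obtain u v where "x = A *v u" "y = A *v v" "\<forall>i. u $ i \<in> \<int>" "\<forall>i. v $ i \<in> \<int>"
      using xy unfolding \<Lambda> by auto
    then show ?thesis
      unfolding \<Lambda> by (intro image_eqI[where x="u-v"]) (auto simp: matrix_vector_mult_diff_distrib)
  qed
  show "c *\<^sub>R x \<in> \<Lambda>" if xy: "x \<in> \<Lambda>" "c \<in> \<int>" for x c
  proof -
    obtain u where "x = A *v u" "\<forall>i. u $ i \<in> \<int>"
      using xy unfolding \<Lambda> by auto
    then show ?thesis
      using xy unfolding \<Lambda>
      by (intro image_eqI[where x="c *\<^sub>R u"]) (auto simp: matrix_vector_mult_scaleR)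
  qed
qed

lemma det_scaleR:
  fixes A :: "real^'n^'n"
  shows "det (c *\<^sub>R A) = c ^ CARD('n) * det A"
proof -
  have "det (c *\<^sub>R A) = det (\<chi> i. c *s (A $ i))"
    by (rule arg_cong[where f=det]) (simp add: vec_eq_iff)
  then show ?thesis
    using det_rows_mul[of "\<lambda>_. c" "\<lambda>i. A $ i"] by simp
qed

lemma lattice_basis_dilate:
  fixes A :: "real^'n^'n"
  assumes "lattice_basis A \<Lambda>" "m > 0"
  shows "lattice_basis (real m *\<^sub>R A) (dilate m \<Lambda>)"
proof -
  have "det (real m *\<^sub>R A) \<noteq> 0"
    using assms by (simp add: det_scaleR lattice_basis_def invertible_det_nz)
  moreover have "(real m *\<^sub>R A) *v x = real m *\<^sub>R (A *v x)" for x
    by (simp add: scaleR_matrix_vector_assoc)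
  ultimately show ?thesis
    using assms by (simp add: lattice_basis_def invertible_det_nz dilate_def image_image)
qed

section \<open>Fundamental cells and lattice point counts\<close>

text \<open>The half-open cube differs from the closed one only in boundary points, a null set. Its
  half-open shape is what lets translates by lattice vectors cover the space without
  overlap.\<close>

lemma measure_linear_image_unit_cube:
  fixes A :: "real^'n^'n"
  defines "D \<equiv> (*v) A ` {x. \<forall>i. 0 \<le> x $ i \<and> x $ i < 1}"
  shows "D \<in> lmeasurable" and "measure lebesgue D = \<bar>det A\<bar>"
proof -
  let ?U = "{x::real^'n. \<forall>i. 0 \<le> x $ i \<and> x $ i < 1}"
  have 1: "(cbox 0 1 - ?U) \<union> (?U - cbox 0 1) \<subseteq> cbox (0::real^'n) 1 - box 0 1"
    by (auto simp: mem_box_cart less_imp_le)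
  then have neg: "negligible ((cbox 0 1 - ?U) \<union> (?U - cbox 0 1))"
    using negligible_frontier_interval negligible_subset by blast
  then have U: "?U \<in> lmeasurable"
    by (rule lmeasurable_negligible_symdiff[OF lmeasurable_cbox])
  have "measure lebesgue ?U = measure lebesgue (cbox (0::real^'n) 1)"
    by (rule measure_negligible_symdiff[OF lmeasurable_cbox neg])
  also have "\<dots> = 1"
    by (simp add: content_cbox_cart interval_eq_empty_cart)
  finally have m: "measure lebesgue ?U = 1" .
  show "D \<in> lmeasurable" unfolding D_def using U by (rule measurable_matrix_image)
  show "measure lebesgue D = \<bar>det A\<bar>"
    unfolding D_def using measure_matrix_image[OF U] m by simp
qed

lemma ball_volume_scale:
  assumes "r \<ge> 0"
  shows "measure lborel (ball (0::real^'n) r) = r ^ CARD('n) * measure lborel (ball (0::real^'n) 1)"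
  using content_ball[of r "0::real^'n"] content_ball[of 1 "0::real^'n"] assms by simp

lemma measure_unit_ball_pos: "measure lborel (ball (0::real^'n) 1) > 0"
  using content_ball_pos[of 1 "0::real^'n"] by simp

text \<open>The half-open fundamental cells attached to the points of a translated lattice tile the
  space; comparing volumes gives both bounds.\<close>

lemma lattice_translate_count:
  fixes A :: "real^'n^'n"
  assumes "lattice_basis A \<Gamma>"
  defines "v \<equiv> measure lborel (ball (0::real^'n) 1)"
  obtains d where "d > 0"
    "\<And>a R. finite ((+) a ` \<Gamma> \<inter> ball 0 R)"
    "\<And>a R. R \<ge> 0 \<Longrightarrow> \<bar>det A\<bar> * real (card ((+) a ` \<Gamma> \<inter> ball 0 R)) \<le> v * (R + d) ^ CARD('n)"
    "\<And>a R. R \<ge> d \<Longrightarrow> v * (R - d) ^ CARD('n) \<le> \<bar>det A\<bar> * real (card ((+) a ` \<Gamma> \<inter> ball 0 R))"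
proof -
  let ?U = "{x::real^'n. \<forall>i. 0 \<le> x $ i \<and> x $ i < 1}"
  define D where "D = (*v) A ` ?U"
  have D: "D \<in> lmeasurable" "measure lebesgue D = \<bar>det A\<bar>"
    unfolding D_def by (rule measure_linear_image_unit_cube)+
  have \<Gamma>: "\<Gamma> = (*v) A ` {z. \<forall>i. z $ i \<in> \<int>}" and inv: "invertible A"
    using assms by (auto simp: lattice_basis_def)
  have nz: "det A \<noteq> 0" using inv by (simp add: invertible_det_nz)
  have injA: "x = y" if "A *v x = A *v y" for x y
    using that inv by (metis inj_matrix_vector_mult injD)
  have "?U \<subseteq> cbox 0 1" by (auto simp: mem_box_cart less_imp_le)
  then have "bounded ?U" using bounded_cbox bounded_subset by blast
  then have "bounded D" unfolding D_def by (intro bounded_linear_image) (simp_all add: linear_linear)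
  \<comment> \<open>The radius \<open>d\<close> controls the boundary error: cells attached to
    points of norm below \<open>R\<close> stay within radius \<open>R + d\<close>, and a cell
    meeting the ball of radius \<open>R - d\<close> is attached to a point of norm below
    \<open>R\<close>.\<close>
  then obtain d where d: "d > 0" "D \<subseteq> ball 0 d"
    by (metis bounded_subset_ballD)
  have cell: "(+) z ` D \<in> lmeasurable" "measure lebesgue ((+) z ` D) = \<bar>det A\<bar>" for z
    using D by (auto simp: measurable_translation measure_translation)
  have disj: "disjnt ((+) x ` D) ((+) y ` D)"
    if xy: "x \<in> (+) a ` \<Gamma>" "y \<in> (+) a ` \<Gamma>" "x \<noteq> y" for x y a
  proof (rule ccontr)
    assume "\<not> ?thesis"
    then obtain u v where uv: "u \<in> ?U" "v \<in> ?U" "x + A *v u = y + A *v v"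
      by (auto simp: disjnt_def D_def)
    obtain s t where st: "x = a + A *v s" "y = a + A *v t" "\<forall>i. s $ i \<in> \<int>" "\<forall>i. t $ i \<in> \<int>"
      using xy by (auto simp: \<Gamma>)
    have "A *v (s + u) = A *v (t + v)"
      using uv(3) st(1,2) by (simp add: matrix_vector_right_distrib)
    then have e: "s + u = t + v" by (rule injA)
    have "s $ i = t $ i" for i
    proof -
      have "s $ i + u $ i = t $ i + v $ i" using e by (metis vector_add_component)
      moreover have "0 \<le> u $ i" "u $ i < 1" "0 \<le> v $ i" "v $ i < 1" using uv by auto
      moreover obtain p q where "s $ i = of_int p" "t $ i = of_int q"
        using st(3,4) by (metis Ints_cases)
      ultimately show ?thesis by auto
    qed
    then have "s = t" by (simp add: vec_eq_iff)
    with st xy(3) show False by simp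
  qed
  have cover: "\<exists>x\<in>(+) a ` \<Gamma>. y \<in> (+) x ` D" for a y
  proof -
    obtain w where w: "y - a = A *v w"
      using inv matrix_right_invertible_surjective[of A] unfolding invertible_def surj_def by metis
    \<comment> \<open>Integer parts select the lattice point, and the fractional parts that remain
      lie in the half-open cube.\<close>
    let ?z = "\<chi> i. of_int \<lfloor>w $ i\<rfloor>"
    have "w - ?z \<in> ?U" using real_of_int_floor_add_one_gt by (auto simp: algebra_simps)
    then have "A *v (w - ?z) \<in> D" unfolding D_def by blast
    moreover have "y = (a + A *v ?z) + A *v (w - ?z)"
      using w by (simp add: matrix_vector_mult_diff_distrib algebra_simps)
    moreover have "a + A *v ?z \<in> (+) a ` \<Gamma>" unfolding \<Gamma> by auto
    ultimately show ?thesis by blast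
  qed
  \<comment> \<open>The bound is stated for finite subsets because finiteness of the whole
    intersection is not yet known. It follows from this bound, which limits the cardinality of every
    finite subset.\<close>
  have upper: "\<bar>det A\<bar> * real (card F) \<le> v * (R + d) ^ CARD('n)"
    if F: "finite F" "F \<subseteq> (+) a ` \<Gamma> \<inter> ball 0 R" and R: "R \<ge> 0" for F a R
  proof -
    have pw: "pairwise (\<lambda>x y. disjnt ((+) x ` D) ((+) y ` D)) F"
      unfolding pairwise_def using F(2) disj[of _ a] by blast
    have "\<bar>det A\<bar> * real (card F) = (\<Sum>x\<in>F. measure lebesgue ((+) x ` D))"
      by (simp add: cell)
    also have "\<dots> = measure lebesgue (\<Union>x\<in>F. (+) x ` D)"
      using F cell pw by (intro measure_UNION'[symmetric]) auto
    also have "\<dots> \<le> measure lebesgue (ball (0::real^'n) (R + d))"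
    proof (rule measure_mono_fmeasurable)
      show "(\<Union>x\<in>F. (+) x ` D) \<subseteq> ball 0 (R + d)"
      proof
        fix y assume "y \<in> (\<Union>x\<in>F. (+) x ` D)"
        then obtain x w where "x \<in> F" "w \<in> D" "y = x + w" by auto
        then have "norm x < R" "norm w < d" using F d by auto
        then show "y \<in> ball 0 (R + d)" using \<open>y = x + w\<close> norm_triangle_lt[of x w "R+d"] by simp
      qed
      show "(\<Union>x\<in>F. (+) x ` D) \<in> sets lebesgue"
        using F cell by (intro sets.finite_UN) auto
    qed simp
    also have "\<dots> = v * (R + d) ^ CARD('n)"
      using R d by (simp add: ball_volume_scale[of "R + d"] v_def)
    finally show ?thesis .
  qed
  have fin: "finite ((+) a ` \<Gamma> \<inter> ball 0 R)" for a R
  proof (cases "R \<ge> 0")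
    case True
    show ?thesis
    proof (rule conjunct1[OF finite_if_finite_subsets_card_bdd])
      fix F assume F: "F \<subseteq> (+) a ` \<Gamma> \<inter> ball 0 R" "finite F"
      then have "real (card F) \<le> v * (R + d) ^ CARD('n) / \<bar>det A\<bar>"
        using upper[of F a R] True nz by (simp add: field_simps)
      then show "card F \<le> nat \<lceil>v * (R + d) ^ CARD('n) / \<bar>det A\<bar>\<rceil>" by linarith
    qed
  qed (simp add: ball_empty)
  have lower: "v * (R - d) ^ CARD('n) \<le> \<bar>det A\<bar> * real (card ((+) a ` \<Gamma> \<inter> ball 0 R))"
    if R: "R \<ge> d" for a R
  proof -
    let ?F = "(+) a ` \<Gamma> \<inter> ball 0 R"
    have pw: "pairwise (\<lambda>x y. disjnt ((+) x ` D) ((+) y ` D)) ?F"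
      unfolding pairwise_def using disj[of _ a] by blast
    have "v * (R - d) ^ CARD('n) = measure lebesgue (ball (0::real^'n) (R - d))"
      using R d by (simp add: ball_volume_scale[of "R - d"] v_def)
    also have "\<dots> \<le> measure lebesgue (\<Union>x\<in>?F. (+) x ` D)"
    proof (rule measure_mono_fmeasurable)
      show "ball 0 (R - d) \<subseteq> (\<Union>x\<in>?F. (+) x ` D)"
      proof
        fix y :: "real^'n" assume y: "y \<in> ball 0 (R - d)"
        obtain x w where x: "x \<in> (+) a ` \<Gamma>" "w \<in> D" "y = x + w" using cover[of a y] by auto
        then have "norm w < d" using d by auto
        then have "norm x < R" using y x(3) norm_triangle_ineq4[of y w] by simp
        then show "y \<in> (\<Union>x\<in>?F. (+) x ` D)" using x by auto
      qed
      show "(\<Union>x\<in>?F. (+) x ` D) \<in> lmeasurable"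
        using fin cell by (intro fmeasurable.finite_UN) auto
    qed simp
    also have "\<dots> = (\<Sum>x\<in>?F. measure lebesgue ((+) x ` D))"
      using fin cell pw by (intro measure_UNION') auto
    also have "\<dots> = \<bar>det A\<bar> * real (card ?F)" by (simp add: cell)
    finally show ?thesis .
  qed
  show thesis
  proof (rule that)
    show "d > 0" by fact
    show "finite ((+) a ` \<Gamma> \<inter> ball 0 R)" for a R by (rule fin)
    show "\<bar>det A\<bar> * real (card ((+) a ` \<Gamma> \<inter> ball 0 R)) \<le> v * (R + d) ^ CARD('n)"
      if "R \<ge> 0" for a R using that fin by (intro upper) auto
    show "v * (R - d) ^ CARD('n) \<le> \<bar>det A\<bar> * real (card ((+) a ` \<Gamma> \<inter> ball 0 R))"
      if "R \<ge> d" for a R using that by (rule lower)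
  qed
qed

lemma finite_lattice_Int_ball:
  assumes "lattice_basis A \<Gamma>"
  shows "finite (\<Gamma> \<inter> ball 0 R)"
proof -
  have "finite ((+) 0 ` \<Gamma> \<inter> ball 0 R)"
    using lattice_translate_count[OF assms] by metis
  then show ?thesis by simp
qed

text \<open>The count times the covolume lies between the volumes of the balls of radius
  \<open>R - d\<close> and \<open>R + d\<close>. As \<open>d\<close> is fixed, both are asymptotic
  to the volume of the ball of radius \<open>R\<close>.\<close>

lemma has_density_lattice_translate:
  fixes A :: "real^'n^'n"
  assumes "lattice_basis A \<Gamma>"
  shows "has_density ((+) a ` \<Gamma>) (1 / \<bar>det A\<bar>)"
proof -
  let ?n = "CARD('n)"
  define v where "v = measure lborel (ball (0::real^'n) 1)"
  have v: "v > 0" unfolding v_def by (rule measure_unit_ball_pos)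
  have nz: "det A \<noteq> 0" using assms by (simp add: lattice_basis_def invertible_det_nz)
  obtain d where d: "d > 0"
    "\<And>R. R \<ge> 0 \<Longrightarrow> \<bar>det A\<bar> * real (card ((+) a ` \<Gamma> \<inter> ball 0 R)) \<le> v * (R + d) ^ ?n"
    "\<And>R. R \<ge> d \<Longrightarrow> v * (R - d) ^ ?n \<le> \<bar>det A\<bar> * real (card ((+) a ` \<Gamma> \<inter> ball 0 R))"
    using lattice_translate_count[OF assms] unfolding v_def by metis
  let ?f = "\<lambda>R. real (card ((+) a ` \<Gamma> \<inter> ball 0 R)) / (R ^ ?n * v)"
  have "((\<lambda>R. d / R) \<longlongrightarrow> 0) at_top"
    by (intro tendsto_divide_0[OF tendsto_const] filterlim_at_top_imp_at_infinity filterlim_ident)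
  \<comment> \<open>The parameter \<open>s\<close> is later -1 for the lower bound and 1 for the
    upper one.\<close>
  then have lim: "((\<lambda>R. (1 + s * (d / R)) ^ ?n / \<bar>det A\<bar>) \<longlongrightarrow> (1 + s * 0) ^ ?n / \<bar>det A\<bar>) at_top" for s
    by (intro tendsto_intros) (use nz in auto)
  have scale: "(1 + s * (d / R)) ^ ?n / \<bar>det A\<bar> = v * (R + s * d) ^ ?n / (\<bar>det A\<bar> * (R ^ ?n * v))"
    if "R > 0" for R s
  proof -
    have "1 + s * (d / R) = (R + s * d) / R" using that by (simp add: field_simps)
    then show ?thesis using v nz by (simp add: power_divide)
  qed
  have "(?f \<longlongrightarrow> 1 / \<bar>det A\<bar>) at_top"
  proof (rule tendsto_sandwich)
    show "((\<lambda>R. (1 + (-1) * (d / R)) ^ ?n / \<bar>det A\<bar>) \<longlongrightarrow> 1 / \<bar>det A\<bar>) at_top"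
      using lim[of "-1"] by simp
    show "((\<lambda>R. (1 + 1 * (d / R)) ^ ?n / \<bar>det A\<bar>) \<longlongrightarrow> 1 / \<bar>det A\<bar>) at_top"
      using lim[of 1] by simp
    show "\<forall>\<^sub>F R in at_top. (1 + (-1) * (d / R)) ^ ?n / \<bar>det A\<bar> \<le> ?f R"
      using eventually_ge_at_top[of d]
    proof eventually_elim
      case (elim R)
      then have R: "R > 0" using d by linarith
      have "v * (R - d) ^ ?n / (\<bar>det A\<bar> * (R ^ ?n * v))
        \<le> \<bar>det A\<bar> * real (card ((+) a ` \<Gamma> \<inter> ball 0 R)) / (\<bar>det A\<bar> * (R ^ ?n * v))"
        using d(3)[OF elim] v R by (intro divide_right_mono) auto
      then show ?case using scale[OF R, of "-1"] nz by simp
    qed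
    show "\<forall>\<^sub>F R in at_top. ?f R \<le> (1 + 1 * (d / R)) ^ ?n / \<bar>det A\<bar>"
      using eventually_gt_at_top[of 0]
    proof eventually_elim
      case (elim R)
      have "\<bar>det A\<bar> * real (card ((+) a ` \<Gamma> \<inter> ball 0 R)) / (\<bar>det A\<bar> * (R ^ ?n * v))
        \<le> v * (R + d) ^ ?n / (\<bar>det A\<bar> * (R ^ ?n * v))"
        using d(2)[of R] v elim by (intro divide_right_mono) auto
      then show ?case using scale[OF elim, of 1] nz by simp
    qed
  qed
  then show ?thesis by (simp add: has_density_def v_def)
qed

lemma lattice_min_norm:
  assumes "lattice_basis A \<Gamma>"
  obtains r where "r > 0" "\<And>x. x \<in> \<Gamma> \<Longrightarrow> x \<noteq> 0 \<Longrightarrow> r \<le> norm x"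
proof -
  \<comment> \<open>Inserting 1 keeps the finite set nonempty and makes \<open>r\<close> a lower
    bound for the points outside the unit ball as well.\<close>
  define r where "r = Min (insert 1 (norm ` ((\<Gamma> - {0}) \<inter> ball 0 1)))"
  have fin: "finite ((\<Gamma> - {0}) \<inter> ball 0 1)"
    by (rule finite_subset[OF _ finite_lattice_Int_ball[OF assms, of 1]]) auto
  have "r > 0" unfolding r_def using fin by (subst Min_gr_iff) auto
  moreover have "r \<le> norm x" if "x \<in> \<Gamma>" "x \<noteq> 0" for x
  proof (cases "norm x < 1")
    case True
    then show ?thesis unfolding r_def using that fin by (intro Min_le) auto
  next
    case False
    moreover have "r \<le> 1" unfolding r_def using fin by (intro Min_le) auto
    ultimately show ?thesis by simp
  qed
  ultimately show thesis by (rule that)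
qed

text \<open>Up to the minimal norm \<open>r\<close> there is nothing to count. Beyond it
  \<open>d \<le> R * (d / r)\<close>, so the boundary term is absorbed into a multiple of
  \<open>R\<close>. The origin must be left out, since it alone would break the bound for small
  \<open>R\<close>.\<close>

lemma lattice_nonzero_count_le:
  fixes A :: "real^'n^'n"
  assumes "lattice_basis A \<Gamma>"
  obtains C where "C > 0"
    "\<And>R. R \<ge> 0 \<Longrightarrow> real (card ((\<Gamma> - {0}) \<inter> ball 0 R)) \<le> C * R ^ CARD('n)"
proof -
  let ?n = "CARD('n)"
  define v where "v = measure lborel (ball (0::real^'n) 1)"
  have v: "v > 0" unfolding v_def by (rule measure_unit_ball_pos)
  have nz: "det A \<noteq> 0" using assms by (simp add: lattice_basis_def invertible_det_nz)
  obtain d where d: "d > 0"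
    "\<And>R. R \<ge> 0 \<Longrightarrow> \<bar>det A\<bar> * real (card ((+) 0 ` \<Gamma> \<inter> ball 0 R)) \<le> v * (R + d) ^ ?n"
    using lattice_translate_count[OF assms] unfolding v_def by metis
  obtain r where r: "r > 0" and r_le: "\<And>x. x \<in> \<Gamma> \<Longrightarrow> x \<noteq> 0 \<Longrightarrow> r \<le> norm x"
    using lattice_min_norm[OF assms] by metis
  define C where "C = v * (1 + d / r) ^ ?n / \<bar>det A\<bar>"
  have C: "C > 0" unfolding C_def using v d r nz by (simp add: add_pos_pos)
  show thesis
  proof (rule that[OF C])
    fix R :: real assume R: "R \<ge> 0"
    show "real (card ((\<Gamma> - {0}) \<inter> ball 0 R)) \<le> C * R ^ ?n"
    proof (cases "R \<le> r")
      case True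
      then have "(\<Gamma> - {0}) \<inter> ball 0 R = {}" using r_le by fastforce
      then show ?thesis using C R by simp
    next
      case False
      have "real (card ((\<Gamma> - {0}) \<inter> ball 0 R)) \<le> real (card (\<Gamma> \<inter> ball 0 R))"
        using finite_lattice_Int_ball[OF assms] by (intro of_nat_mono card_mono) auto
      also have "\<dots> \<le> v * (R + d) ^ ?n / \<bar>det A\<bar>"
        using d(2)[OF R] nz by (simp add: field_simps)
      also have "\<dots> \<le> v * (R * (1 + d / r)) ^ ?n / \<bar>det A\<bar>"
      proof -
        have "d \<le> R * (d / r)" using False d r by (simp add: field_simps)
        then show ?thesis using v R d
          by (intro divide_right_mono mult_left_mono power_mono) (auto simp: algebra_simps)
      qed
      also have "\<dots> = C * R ^ ?n" by (simp add: C_def power_mult_distrib)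
      finally show ?thesis .
    qed
  qed
qed

section \<open>Finite additivity of the density\<close>

lemma has_density_diff:
  assumes "X \<subseteq> Y" "\<And>R. finite (Y \<inter> ball 0 R)" "has_density Y d" "has_density X e"
  shows "has_density (Y - X) (d - e)"
proof -
  have "real (card ((Y - X) \<inter> ball 0 R)) = real (card (Y \<inter> ball 0 R)) - real (card (X \<inter> ball 0 R))"
    for R
  proof -
    have "(Y - X) \<inter> ball 0 R = Y \<inter> ball 0 R - X \<inter> ball 0 R" by auto
    moreover have sub: "X \<inter> ball 0 R \<subseteq> Y \<inter> ball 0 R" using assms(1) by auto
    ultimately show ?thesis
      using assms(2)[of R] card_mono[OF assms(2) sub] finite_subset[OF sub assms(2)]
      by (simp add: card_Diff_subset[OF _ sub] of_nat_diff)
  qed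
  then show ?thesis
    using tendsto_diff[OF assms(3,4)[unfolded has_density_def]]
    by (simp add: has_density_def diff_divide_distrib)
qed

lemma has_density_UN:
  assumes "finite I" "disjoint_family_on X I" "\<And>i R. i \<in> I \<Longrightarrow> finite (X i \<inter> ball 0 R)"
    "\<And>i. i \<in> I \<Longrightarrow> has_density (X i) (d i)"
  shows "has_density (\<Union>i\<in>I. X i) (\<Sum>i\<in>I. d i)"
proof -
  have "real (card ((\<Union>i\<in>I. X i) \<inter> ball 0 R)) = (\<Sum>i\<in>I. real (card (X i \<inter> ball 0 R)))" for R
  proof -
    have "(\<Union>i\<in>I. X i) \<inter> ball 0 R = (\<Union>i\<in>I. X i \<inter> ball 0 R)" by auto
    moreover have "card (\<Union>i\<in>I. X i \<inter> ball 0 R) = (\<Sum>i\<in>I. card (X i \<inter> ball 0 R))"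
      using assms(1-3) by (intro card_UN_disjoint) (auto simp: disjoint_family_on_def)
    ultimately show ?thesis by simp
  qed
  then show ?thesis
    using tendsto_sum[of I, OF assms(4)[unfolded has_density_def]]
    by (simp add: has_density_def sum_divide_distrib)
qed

section \<open>Sieving by finitely many primes\<close>

lemma mem_dilate_iff: "x \<in> dilate m \<Lambda> \<longleftrightarrow> (\<exists>y\<in>\<Lambda>. x = real m *\<^sub>R y)"
  by (auto simp: dilate_def)

lemma mem_translate_iff: "(t :: real^'n) \<in> (+) a ` S \<longleftrightarrow> t - a \<in> S"
  by (auto simp: image_iff intro: bexI[of _ "t - a"])

text \<open>This is the Chinese remainder theorem for cosets, obtained from a Bezout identity
  \<open>u * m + v * q = 1\<close>.\<close>

lemma coset_Int_coset:
  assumes "lattice_basis A \<Lambda>" "coprime m q" "a \<in> \<Lambda>" "b \<in> \<Lambda>"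
  obtains c where "c \<in> \<Lambda>"
    "(+) a ` dilate m \<Lambda> \<inter> (+) b ` dilate q \<Lambda> = (+) c ` dilate (m * q) \<Lambda>"
proof -
  note grp = lattice_basis_add[OF assms(1)] lattice_basis_diff[OF assms(1)]
    lattice_basis_scale[OF assms(1)]
  obtain u v :: int where "u * int m + v * int q = 1"
    using bezout_int[of "int m" "int q"] assms(2) by auto
  then have "of_int (u * int m + v * int q) = (1::real)" by simp
  then have uv: "of_int u * real m + of_int v * real q = 1" by simp
  \<comment> \<open>This point differs from \<open>a\<close> by a multiple of \<open>m\<close>. By
    the Bezout identity it also differs from \<open>b\<close> by a multiple of \<open>q\<close>,
    which is the form \<open>c'\<close>.\<close>
  define c where "c = a + (of_int u * real m) *\<^sub>R (b - a)"
  have "of_int u * real m = 1 - of_int v * real q" using uv by simp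
  then have c': "c = b - (of_int v * real q) *\<^sub>R (b - a)"
    unfolding c_def by (simp add: scaleR_left_diff_distrib)
  have "c \<in> \<Lambda>" unfolding c_def using assms by (intro grp) auto
  moreover have "(+) a ` dilate m \<Lambda> \<inter> (+) b ` dilate q \<Lambda> = (+) c ` dilate (m * q) \<Lambda>"
  proof (intro equalityI subsetI)
    fix y assume "y \<in> (+) a ` dilate m \<Lambda> \<inter> (+) b ` dilate q \<Lambda>"
    then obtain s t where st: "s \<in> \<Lambda>" "t \<in> \<Lambda>" "y = a + real m *\<^sub>R s" "y = b + real q *\<^sub>R t"
      by (auto simp: mem_dilate_iff)
    define w where "w = s - of_int u *\<^sub>R (b - a)"
    define w' where "w' = t + of_int v *\<^sub>R (b - a)"
    have 1: "y - c = real m *\<^sub>R w"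
      unfolding c_def st(3) w_def by (simp add: algebra_simps)
    have 2: "y - c = real q *\<^sub>R w'"
      unfolding c' st(4) w'_def by (simp add: algebra_simps)
    \<comment> \<open>Multiply \<open>y - c\<close> by \<open>1 = u * m + v * q\<close> and use in
      each summand the divisibility that supplies the missing factor.\<close>
    have "y - c = (of_int u * real m) *\<^sub>R (y - c) + (of_int v * real q) *\<^sub>R (y - c)"
      using uv by (metis scaleR_left_distrib scaleR_one)
    also have "\<dots> = (of_int u * real m) *\<^sub>R (real q *\<^sub>R w') + (of_int v * real q) *\<^sub>R (real m *\<^sub>R w)"
      using 1 2 by simp
    also have "\<dots> = real (m * q) *\<^sub>R (of_int u *\<^sub>R w' + of_int v *\<^sub>R w)"
      by (simp add: algebra_simps)
    finally have "y - c = \<dots>" .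
    moreover have "of_int u *\<^sub>R w' + of_int v *\<^sub>R w \<in> \<Lambda>"
      unfolding w_def w'_def using st assms by (intro grp) auto
    ultimately show "y \<in> (+) c ` dilate (m * q) \<Lambda>"
      by (auto simp: mem_translate_iff mem_dilate_iff)
  next
    fix y assume "y \<in> (+) c ` dilate (m * q) \<Lambda>"
    then obtain w where w: "w \<in> \<Lambda>" "y = c + real (m * q) *\<^sub>R w"
      by (auto simp: mem_dilate_iff)
    have "y - a = real m *\<^sub>R (of_int u *\<^sub>R (b - a) + of_int (int q) *\<^sub>R w)"
      unfolding w c_def by (simp add: algebra_simps)
    moreover have "of_int u *\<^sub>R (b - a) + of_int (int q) *\<^sub>R w \<in> \<Lambda>"
      using w assms by (intro grp) auto
    moreover have "y - b = real q *\<^sub>R (of_int (int m) *\<^sub>R w - of_int v *\<^sub>R (b - a))"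
      unfolding w c' by (simp add: algebra_simps)
    moreover have "of_int (int m) *\<^sub>R w - of_int v *\<^sub>R (b - a) \<in> \<Lambda>"
      using w assms by (intro grp) auto
    ultimately show "y \<in> (+) a ` dilate m \<Lambda> \<inter> (+) b ` dilate q \<Lambda>"
      by (auto simp: mem_translate_iff mem_dilate_iff)
  qed
  ultimately show thesis by (rule that)
qed

text \<open>A truncation of the locator set with empty \<open>Q\<close>. For a finite set
  \<open>T\<close> of primes it is periodic modulo the product of the numbers \<open>p ^ k\<close>,
  which makes its density computable.\<close>

definition sieved_set :: "(real^'n) set \<Rightarrow> nat \<Rightarrow> (real^'n) set \<Rightarrow> nat set \<Rightarrow> (real^'n) set" where
  "sieved_set \<Lambda> k P T = {t \<in> \<Lambda>. \<forall>p\<in>T. \<forall>x\<in>P. x + t \<notin> dilate (p ^ k) \<Lambda>}"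

lemma coset_eq_iff:
  assumes "lattice_basis A \<Lambda>" "m > 0"
  shows "(+) x ` dilate m \<Lambda> = (+) y ` dilate m \<Lambda> \<longleftrightarrow> x - y \<in> dilate m \<Lambda>"
proof -
  note B = lattice_basis_dilate[OF assms]
  show ?thesis
  proof
    assume "(+) x ` dilate m \<Lambda> = (+) y ` dilate m \<Lambda>"
    moreover have "x \<in> (+) x ` dilate m \<Lambda>" using lattice_basis_zero[OF B] by force
    ultimately show "x - y \<in> dilate m \<Lambda>" by (simp add: mem_translate_iff)
  next
    assume xy: "x - y \<in> dilate m \<Lambda>"
    have "t - x \<in> dilate m \<Lambda> \<longleftrightarrow> t - y \<in> dilate m \<Lambda>" for t
      using lattice_basis_add[OF B xy, of "t - x"] lattice_basis_diff[OF B _ xy, of "t - y"]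
      by (auto simp: algebra_simps)
    then show "(+) x ` dilate m \<Lambda> = (+) y ` dilate m \<Lambda>"
      by (auto simp: set_eq_iff mem_translate_iff)
  qed
qed

text \<open>Induction on the set of primes: passing to one more prime removes, for each coset it excludes,
  a piece which by the Chinese remainder theorem is a sieved coset of a sparser sublattice.\<close>

lemma has_density_sieved_coset:
  fixes A :: "real^'n^'n"
  assumes A: "lattice_basis A \<Lambda>" "\<bar>det A\<bar> = 1" and P: "finite P" "P \<subseteq> \<Lambda>"
    and T: "finite T" "\<And>p. p \<in> T \<Longrightarrow> prime p"
    and m: "m > 0" "\<And>p. p \<in> T \<Longrightarrow> coprime m p" and a: "a \<in> \<Lambda>"
  shows "has_density ((+) a ` dilate m \<Lambda> \<inter> sieved_set \<Lambda> k P T)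
    ((\<Prod>p\<in>T. euler_factor \<Lambda> k P p) / real m ^ CARD('n))"
  using T m a
proof (induction T arbitrary: m a rule: finite_induct)
  case empty
  note B = lattice_basis_dilate[OF A(1) \<open>m > 0\<close>]
  have "(+) a ` dilate m \<Lambda> \<subseteq> \<Lambda>"
  proof
    fix y assume "y \<in> (+) a ` dilate m \<Lambda>"
    then obtain w where w: "w \<in> \<Lambda>" "y = a + of_int (int m) *\<^sub>R w"
      by (auto simp: mem_dilate_iff)
    then show "y \<in> \<Lambda>"
      using empty.prems lattice_basis_add[OF A(1)] lattice_basis_scale[OF A(1)] Ints_of_int by blast
  qed
  then have "(+) a ` dilate m \<Lambda> \<inter> sieved_set \<Lambda> k P {} = (+) a ` dilate m \<Lambda>"
    by (auto simp: sieved_set_def)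
  then show ?case
    using has_density_lattice_translate[OF B, of a] A(2) by (simp add: det_scaleR abs_mult)
next
  case (insert q T)
  let ?n = "CARD('n)"
  let ?e = "\<Prod>p\<in>T. euler_factor \<Lambda> k P p"
  define Q where "Q = q ^ k"
  have q: "prime q" and Q: "Q > 0" using insert.prems(1)[of q] by (auto simp: Q_def prime_gt_0_nat)
  define X where "X = (+) a ` dilate m \<Lambda> \<inter> sieved_set \<Lambda> k P T"
  define K where "K = cosets_of P Q \<Lambda>"
  \<comment> \<open>Coprimality to the remaining primes survives multiplication by \<open>Q\<close>,
    so the induction hypothesis also covers the sparser modulus \<open>m * Q\<close>.\<close>
  have cop: "coprime (m * Q) p" if "p \<in> T" for p
  proof -
    have "coprime q p"
      using that insert.hyps insert.prems(1) by (intro primes_coprime) auto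
    then show ?thesis using that insert.prems by (auto simp: Q_def)
  qed
  have finX: "finite (Y \<inter> ball 0 R)" if "Y \<subseteq> X" for Y R
    using that by (intro finite_subset[OF _ finite_lattice_Int_ball[OF A(1), of R]])
      (auto simp: X_def sieved_set_def)
  have neg: "t \<in> uminus ` c \<longleftrightarrow> - t \<in> c" for t :: "real^'n" and c
    by (metis image_iff minus_minus)
  have dX: "has_density X (?e / real m ^ ?n)"
    unfolding X_def using insert.prems by (intro insert.IH) auto
  \<comment> \<open>The new prime excludes \<open>t\<close> when \<open>x + t\<close> lies in the
    dilate by \<open>Q\<close> for some \<open>x\<close> in \<open>P\<close>, that is, when
    \<open>-t\<close> lies in a coset from \<open>K\<close>. Negated cosets thus index the excluded
    pieces, and their number is the one in \<open>euler_factor\<close>.\<close>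
  have piece: "has_density (X \<inter> uminus ` c) (?e / real (m * Q) ^ ?n)" if c: "c \<in> K" for c
  proof -
    obtain x where x: "x \<in> P" "c = (+) x ` dilate Q \<Lambda>"
      using c by (auto simp: K_def cosets_of_def)
    have "-x \<in> \<Lambda>"
      using lattice_basis_diff[OF A(1) lattice_basis_zero[OF A(1)], of x] x P by auto
    moreover have "coprime m Q" using insert.prems by (auto simp: Q_def)
    ultimately obtain b where b: "b \<in> \<Lambda>"
      "(+) a ` dilate m \<Lambda> \<inter> (+) (-x) ` dilate Q \<Lambda> = (+) b ` dilate (m * Q) \<Lambda>"
      using coset_Int_coset[OF A(1), of m Q a "-x"] insert.prems by metis
    have sym: "- y \<in> dilate Q \<Lambda> \<longleftrightarrow> y \<in> dilate Q \<Lambda>" for y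
      using lattice_basis_diff[OF lattice_basis_dilate[OF A(1) Q], of 0]
        lattice_basis_zero[OF lattice_basis_dilate[OF A(1) Q]]
      by (metis diff_0 minus_minus)
    have "- y - x \<in> dilate Q \<Lambda> \<longleftrightarrow> y - (- x) \<in> dilate Q \<Lambda>" for y
      using sym[of "y + x"] by simp
    then have "y \<in> uminus ` c \<longleftrightarrow> y \<in> (+) (-x) ` dilate Q \<Lambda>" for y
      unfolding neg x(2) mem_translate_iff .
    then have "uminus ` c = (+) (-x) ` dilate Q \<Lambda>" by blast
    then have "X \<inter> uminus ` c = (+) b ` dilate (m * Q) \<Lambda> \<inter> sieved_set \<Lambda> k P T"
      using b(2) by (auto simp: X_def)
    then show ?thesis
      using insert.IH[of "m * Q" b] insert.prems b Q cop by simp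
  qed
  have "has_density (\<Union>c\<in>K. X \<inter> uminus ` c) (\<Sum>c\<in>K. ?e / real (m * Q) ^ ?n)"
  proof (rule has_density_UN)
    show "finite K" unfolding K_def cosets_of_def using P by simp
    have "c = c'" if cy: "c \<in> K" "c' \<in> K" "y \<in> c" "y \<in> c'" for c c' y
    proof -
      obtain x x' where x: "c = (+) x ` dilate Q \<Lambda>" "c' = (+) x' ` dilate Q \<Lambda>"
        using cy by (auto simp: K_def cosets_of_def)
      then have "(+) y ` dilate Q \<Lambda> = c" "(+) y ` dilate Q \<Lambda> = c'"
        using cy(3,4) unfolding x mem_translate_iff by (simp_all add: coset_eq_iff[OF A(1) Q])
      then show ?thesis by simp
    qed
    then show "disjoint_family_on (\<lambda>c. X \<inter> uminus ` c) K"
      unfolding disjoint_family_on_def using neg by blast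
    show "finite (X \<inter> uminus ` c \<inter> ball 0 R)" for c R by (rule finX) auto
    show "has_density (X \<inter> uminus ` c) (?e / real (m * Q) ^ ?n)" if "c \<in> K" for c
      using that by (rule piece)
  qed
  then have dU: "has_density (\<Union>c\<in>K. X \<inter> uminus ` c) (real (card K) * (?e / real (m * Q) ^ ?n))"
    by simp
  have "has_density (X - (\<Union>c\<in>K. X \<inter> uminus ` c))
      (?e / real m ^ ?n - real (card K) * (?e / real (m * Q) ^ ?n))"
    by (rule has_density_diff[OF _ finX dX dU]) auto
  moreover have "X - (\<Union>c\<in>K. X \<inter> uminus ` c)
      = (+) a ` dilate m \<Lambda> \<inter> sieved_set \<Lambda> k P (insert q T)"
  proof -
    have "-t - x \<in> dilate Q \<Lambda> \<longleftrightarrow> x + t \<in> dilate Q \<Lambda>" for t x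
      using lattice_basis_diff[OF lattice_basis_dilate[OF A(1) Q], of 0]
        lattice_basis_zero[OF lattice_basis_dilate[OF A(1) Q]]
      by (metis diff_0 minus_add_distrib minus_diff_commute minus_minus uminus_add_conv_diff)
    then have "- t \<in> (+) x ` dilate Q \<Lambda> \<longleftrightarrow> x + t \<in> dilate Q \<Lambda>" for t x
      by (simp add: mem_translate_iff)
    then have U: "t \<in> (\<Union>c\<in>K. X \<inter> uminus ` c) \<longleftrightarrow> t \<in> X \<and> (\<exists>x\<in>P. x + t \<in> dilate Q \<Lambda>)" for t
      by (simp add: K_def cosets_of_def neg)
    have S: "t \<in> sieved_set \<Lambda> k P (insert q T)
        \<longleftrightarrow> t \<in> sieved_set \<Lambda> k P T \<and> (\<forall>x\<in>P. x + t \<notin> dilate Q \<Lambda>)" for t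
      by (auto simp: sieved_set_def Q_def)
    have X: "t \<in> X \<longleftrightarrow> t \<in> (+) a ` dilate m \<Lambda> \<and> t \<in> sieved_set \<Lambda> k P T" for t
      unfolding X_def by (rule Int_iff)
    show ?thesis
      unfolding set_eq_iff Diff_iff Int_iff U S X by metis
  qed
  moreover have "?e / real m ^ ?n - real (card K) * (?e / real (m * Q) ^ ?n)
      = (\<Prod>p\<in>insert q T. euler_factor \<Lambda> k P p) / real m ^ ?n"
  proof -
    have "real Q ^ ?n = real q ^ (?n * k)"
      unfolding Q_def by (simp only: of_nat_power power_mult[symmetric] mult.commute)
    then have e: "euler_factor \<Lambda> k P q = 1 - real (card K) / real Q ^ ?n"
      using q by (simp add: euler_factor_def K_def Q_def)
    have "u / x - c * (u / (x * y)) = (1 - c / y) * u / x" for u x y c :: real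
      by (simp add: algebra_simps diff_divide_distrib)
    then show ?thesis
      unfolding prod.insert[OF insert.hyps] e of_nat_mult power_mult_distrib .
  qed
  ultimately show ?case by simp
qed

lemma has_density_sieved_set:
  fixes A :: "real^'n^'n"
  assumes "lattice_basis A \<Lambda>" "\<bar>det A\<bar> = 1" "finite P" "P \<subseteq> \<Lambda>" "finite T"
    "\<And>p. p \<in> T \<Longrightarrow> prime p"
  shows "has_density (sieved_set \<Lambda> k P T) (\<Prod>p\<in>T. euler_factor \<Lambda> k P p)"
proof -
  have "(+) 0 ` dilate 1 \<Lambda> \<inter> sieved_set \<Lambda> k P T = sieved_set \<Lambda> k P T"
    by (auto simp: dilate_def sieved_set_def)
  then show ?thesis
    using has_density_sieved_coset[OF assms, of 1 0 k] lattice_basis_zero[OF assms(1)] by simp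
qed

section \<open>All primes\<close>

text \<open>If a nonzero point lies in the dilate by \<open>c ^ k\<close> with \<open>c > 1\<close>,
  it lies in the dilate by \<open>p ^ k\<close> for any prime factor \<open>p\<close> of
  \<open>c\<close>. So content 1 need only be tested at primes.\<close>

lemma mem_k_free_points_iff:
  assumes A: "lattice_basis A \<Lambda>" and k: "k \<ge> 1"
  shows "l \<in> k_free_points \<Lambda> k \<longleftrightarrow> l \<in> \<Lambda> \<and> l \<noteq> 0 \<and> (\<forall>p. prime p \<longrightarrow> l \<notin> dilate (p ^ k) \<Lambda>)"
proof (cases "l \<in> \<Lambda> \<and> l \<noteq> 0")
  case False
  then show ?thesis by (auto simp: k_free_points_def k_content_def one_enat_def)
next
  case True
  let ?C = "\<lambda>c. l \<in> dilate (c ^ k) \<Lambda>"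
  obtain r where r: "r > 0" "\<And>x. x \<in> \<Lambda> \<Longrightarrow> x \<noteq> 0 \<Longrightarrow> r \<le> norm x"
    using lattice_min_norm[OF A] by metis
  \<comment> \<open>\<open>GREATEST\<close> is controlled only for a bounded predicate. The minimal
    norm \<open>r\<close> gives \<open>c ^ k * r \<le> norm l\<close>, and
    \<open>c \<le> c ^ k\<close> because \<open>k\<close> is positive.\<close>
  have bound: "c \<le> nat \<lceil>norm l / r\<rceil>" if c: "?C c" for c
  proof -
    obtain y where y: "y \<in> \<Lambda>" "l = real (c ^ k) *\<^sub>R y" using c unfolding mem_dilate_iff by blast
    then have "y \<noteq> 0" using True by auto
    then have "real (c ^ k) * r \<le> norm l" using y r(2)[of y] by (simp add: mult_left_mono)
    then have "real (c ^ k) \<le> norm l / r" using r by (simp add: field_simps)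
    moreover have "c \<le> c ^ k" using k by (cases "c = 0") (auto intro: self_le_power)
    ultimately show ?thesis by linarith
  qed
  have one: "?C 1" using True by (simp add: dilate_def)
  have eq: "(GREATEST c. ?C c) = 1 \<longleftrightarrow> (\<forall>p. prime p \<longrightarrow> \<not> ?C p)"
  proof
    assume g: "(GREATEST c. ?C c) = 1"
    have "c \<le> 1" if "?C c" for c
      using Greatest_le_nat[of ?C c, OF that] bound g by metis
    then show "\<forall>p. prime p \<longrightarrow> \<not> ?C p" by (metis not_prime_1 prime_gt_1_nat leD)
  next
    assume pr: "\<forall>p. prime p \<longrightarrow> \<not> ?C p"
    show "(GREATEST c. ?C c) = 1"
    proof (rule Greatest_equality)
      fix c assume c: "?C c"
      show "c \<le> 1"
      proof (rule ccontr)
        assume "\<not> c \<le> 1"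
        then obtain p d where pd: "prime p" "c = p * d" using prime_factor_nat[of c] by (auto simp: dvd_def)
        obtain y where y: "y \<in> \<Lambda>" "l = real (c ^ k) *\<^sub>R y" using c unfolding mem_dilate_iff by blast
        have "of_int (int (d ^ k)) *\<^sub>R y \<in> \<Lambda>" using y by (intro lattice_basis_scale[OF A]) auto
        moreover have "l = real (p ^ k) *\<^sub>R (of_int (int (d ^ k)) *\<^sub>R y)"
          using y pd by (simp add: power_mult_distrib)
        ultimately show False using pr pd(1) unfolding mem_dilate_iff by blast
      qed
    qed (rule one)
  qed
  show ?thesis using True eq by (simp add: k_free_points_def k_content_def one_enat_def)
qed

text \<open>This links the locator set to the sieve: being \<open>k\<close>-free means avoiding all
  dilates by \<open>p ^ k\<close> and being nonzero, and \<open>x + t\<close> is nonzero for all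
  \<open>x\<close> in \<open>P\<close> exactly when \<open>t\<close> is not the negative of a point
  of \<open>P\<close>.\<close>

lemma locator_set_empty:
  assumes "lattice_basis A \<Lambda>" "k \<ge> 1" "P \<subseteq> \<Lambda>"
  shows "locator_set \<Lambda> (k_free_points \<Lambda> k) P {}
    = sieved_set \<Lambda> k P (Collect prime) - uminus ` P"
proof -
  have "x + t = 0 \<longleftrightarrow> t = - x" for x t :: "real^'a" by (metis add_eq_0_iff)
  then show ?thesis
    using assms lattice_basis_add[OF assms(1)]
    by (auto simp: locator_set_def sieved_set_def mem_k_free_points_iff subset_iff image_iff)
qed

text \<open>The count \<open>C * R ^ n\<close> of nonzero lattice points holds for all \<open>R \<ge> 0\<close>, not only for large
  ones, so it can be applied to the rescaled radii \<open>R / m ^ k\<close> and summed over \<open>m\<close>. Primality of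
  \<open>m\<close> plays no role in this bound.\<close>

lemma large_multiples_count_le:
  fixes A :: "real^'n^'n"
  assumes A: "lattice_basis A \<Lambda>" and nk: "CARD('n) * k \<ge> 2"
  obtains C where "C > 0"
    "\<And>N R. R \<ge> 0 \<Longrightarrow> real (card ((\<Union>m\<in>{N<..}. dilate (m ^ k) \<Lambda> - {0}) \<inter> ball 0 R))
      \<le> C * R ^ CARD('n) * (\<Sum>i. 1 / real (i + Suc N) ^ 2)"
proof -
  let ?n = "CARD('n)"
  obtain C where C: "C > 0"
    "\<And>R. R \<ge> 0 \<Longrightarrow> real (card ((\<Lambda> - {0}) \<inter> ball 0 R)) \<le> C * R ^ ?n"
    using lattice_nonzero_count_le[OF A] by metis
  show thesis
  proof (rule that[OF C(1)])
    fix N :: nat and R :: real assume R: "R \<ge> 0"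
    let ?W = "\<lambda>m. (dilate (m ^ k) \<Lambda> - {0}) \<inter> ball 0 R"
    let ?U = "(\<Union>m\<in>{N<..}. dilate (m ^ k) \<Lambda> - {0}) \<inter> ball 0 R"
    have "dilate m \<Lambda> \<subseteq> \<Lambda>" for m
      using lattice_basis_scale[OF A, of _ "real m"] by (auto simp: dilate_def)
    then have fin: "finite ?U"
      by (intro finite_subset[OF _ finite_lattice_Int_ball[OF A, of R]]) auto
    have "\<forall>y\<in>?U. \<exists>m>N. y \<in> ?W m" by auto
    \<comment> \<open>Each of the finitely many points chooses one witness \<open>m\<close>. The
      chosen witnesses form a finite index set, so the union bound applies even though infinitely
      many \<open>m\<close> are allowed.\<close>
    then obtain f where f: "\<And>y. y \<in> ?U \<Longrightarrow> f y > N \<and> y \<in> ?W (f y)" by metis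
    define S where "S = f ` ?U"
    have S: "finite S" "S \<subseteq> {N<..}" unfolding S_def using fin f by blast+
    have sub: "?U \<subseteq> (\<Union>m\<in>S. ?W m)" unfolding S_def using f by blast
    have W: "finite (?W m) \<and> real (card (?W m)) \<le> C * R ^ ?n * (1 / real m ^ 2)" if "m > N" for m
    proof -
      let ?g = "(*\<^sub>R) (real (m ^ k))"
      have pos: "real (m ^ k) > 0" using that by simp
      have im: "?W m = ?g ` ((\<Lambda> - {0}) \<inter> ball 0 (R / real (m ^ k)))"
        using pos by (auto simp: dilate_def image_iff field_simps)
      have "finite ((\<Lambda> - {0}) \<inter> ball 0 (R / real (m ^ k)))"
        by (rule finite_subset[OF _ finite_lattice_Int_ball[OF A]]) auto
      moreover from this have "real (card (?W m)) \<le> real (card ((\<Lambda> - {0}) \<inter> ball 0 (R / real (m ^ k))))"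
        unfolding im by (intro of_nat_mono card_image_le)
      moreover have "\<dots> \<le> C * (R / real (m ^ k)) ^ ?n"
        using R by (intro C) auto
      moreover have "\<dots> = C * R ^ ?n * (1 / real m ^ (?n * k))"
        by (simp add: power_divide power_mult[symmetric] mult.commute)
      \<comment> \<open>Here \<open>n * k \<ge> 2\<close> enters, replacing the exponent by 2, for
        which the sum over \<open>m\<close> converges.\<close>
      moreover have "\<dots> \<le> C * R ^ ?n * (1 / real m ^ 2)"
        using that nk C(1) R
        by (intro mult_left_mono divide_left_mono power_increasing) auto
      ultimately show ?thesis unfolding im by simp
    qed
    have sm: "summable (\<lambda>i. 1 / real (i + Suc N) ^ 2)"
      using summable_ignore_initial_segment[OF inverse_power_summable[of 2, where 'a=real], of "Suc N"]
      by (simp add: field_simps)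
    have "finite (\<Union>m\<in>S. ?W m)"
      using S W by (intro finite_UN_I) blast+
    then have "real (card ?U) \<le> real (card (\<Union>m\<in>S. ?W m))"
      by (rule of_nat_mono[OF card_mono[OF _ sub]])
    also have "\<dots> \<le> (\<Sum>m\<in>S. real (card (?W m)))"
      using of_nat_mono[OF card_UN_le[OF S(1), of ?W], where 'a=real] by (simp only: of_nat_sum)
    also have "\<dots> \<le> (\<Sum>m\<in>S. C * R ^ ?n * (1 / real m ^ 2))"
      using S W by (intro sum_mono) auto
    also have "\<dots> = C * R ^ ?n * (\<Sum>m\<in>S. 1 / real m ^ 2)" by (simp add: sum_distrib_left)
    \<comment> \<open>Reindexed by \<open>i = m - Suc N\<close>; no truncation occurs since every
      \<open>m\<close> in \<open>S\<close> exceeds \<open>N\<close>.\<close>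
    also have "(\<Sum>m\<in>S. 1 / real m ^ 2) = (\<Sum>i\<in>(\<lambda>m. m - Suc N) ` S. 1 / real (i + Suc N) ^ 2)"
      using S(2) by (subst sum.reindex[OF inj_on_diff_nat]) (auto intro!: sum.cong)
    also have "\<dots> \<le> (\<Sum>i. 1 / real (i + Suc N) ^ 2)"
      using S(1) by (intro sum_le_suminf[OF sm]) auto
    finally show "real (card ?U) \<le> C * R ^ ?n * (\<Sum>i. 1 / real (i + Suc N) ^ 2)"
      using C R by (simp add: mult_left_mono)
  qed
qed

text \<open>At most \<open>card F\<close> cosets are represented, so a factor differs from 1 by at
  most \<open>card F / p ^ 2\<close>. The notion \<open>convergent_prod\<close> tolerates finitely
  many vanishing factors.\<close>

lemma convergent_prod_euler_factor:
  fixes \<Lambda> F :: "(real^'n) set"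
  assumes "finite F" "CARD('n) * k \<ge> 2"
  shows "convergent_prod (euler_factor \<Lambda> k F)"
proof -
  have "summable (\<lambda>p. norm (euler_factor \<Lambda> k F p - 1))"
  proof (rule summable_comparison_test'[where N=1])
    show "summable (\<lambda>p. real (card F) * (1 / real p ^ 2))"
      using inverse_power_summable[of 2, where 'a=real] by (intro summable_mult) (simp add: field_simps)
    fix p :: nat assume p: "p \<ge> 1"
    have "real (card (cosets_of F (p ^ k) \<Lambda>)) / real p ^ (CARD('n) * k) \<le> real (card F) / real p ^ 2"
      using assms p unfolding cosets_of_def
      by (intro frac_le power_increasing of_nat_mono card_image_le) auto
    then show "norm (norm (euler_factor \<Lambda> k F p - 1)) \<le> real (card F) * (1 / real p ^ 2)"
      by (simp add: euler_factor_def)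
  qed
  then show ?thesis
    by (intro abs_convergent_prod_imp_convergent_prod summable_imp_abs_convergent_prod)
qed

text \<open>The finite sieves \<open>S N\<close> contain the locator set, and their excess density
  is bounded by a multiple of \<open>\<epsilon> N\<close>. Choosing \<open>N\<close> first and then
  \<open>R\<close> large exchanges the two limits.\<close>

lemma has_density_locator_set_empty:
  fixes A :: "real^'n^'n"
  assumes A: "lattice_basis A \<Lambda>" "\<bar>det A\<bar> = 1" and k: "k \<ge> 1" "CARD('n) * k \<ge> 2"
    and P: "finite P" "P \<subseteq> \<Lambda>"
  shows "has_density (locator_set \<Lambda> (k_free_points \<Lambda> k) P {}) (prodinf (euler_factor \<Lambda> k P))"
proof -
  let ?n = "CARD('n)"
  define v where "v = measure lborel (ball (0::real^'n) 1)"
  have v: "v > 0" unfolding v_def by (rule measure_unit_ball_pos)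
  define L where "L = locator_set \<Lambda> (k_free_points \<Lambda> k) P {}"
  define pr where "pr = (\<lambda>N::nat. {p. prime p \<and> p \<le> N})"
  define S where "S = (\<lambda>N. sieved_set \<Lambda> k P (pr N))"
  define \<epsilon> where "\<epsilon> = (\<lambda>N. \<Sum>i. 1 / real (i + Suc N) ^ 2)"
  have LS: "L \<subseteq> S N" for N
    unfolding L_def S_def locator_set_empty[OF A(1) k(1) P(2)] by (auto simp: sieved_set_def pr_def)
  have finS: "finite (S N \<inter> ball 0 R)" for N R
    by (rule finite_subset[OF _ finite_lattice_Int_ball[OF A(1), of R]])
      (auto simp: S_def sieved_set_def)
  obtain C where C: "C > 0"
    "\<And>N R. R \<ge> 0 \<Longrightarrow> real (card ((\<Union>m\<in>{N<..}. dilate (m ^ k) \<Lambda> - {0}) \<inter> ball 0 R))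
      \<le> C * R ^ ?n * \<epsilon> N"
    using large_multiples_count_le[OF A(1) k(2)] unfolding \<epsilon>_def by metis
  obtain \<rho> where \<rho>: "\<And>x. x \<in> P \<Longrightarrow> norm x \<le> \<rho>" "\<rho> > 0"
    using finite_imp_bounded[OF P(1)] by (meson bounded_pos)
  \<comment> \<open>For \<open>R \<ge> \<rho>\<close> a shift by \<open>x\<close> in
    \<open>P\<close> keeps points inside radius \<open>2 * R\<close>. The summand 1 accounts for
    \<open>x + t = 0\<close>; otherwise \<open>x + t\<close> is a nonzero multiple coming from a
    prime above \<open>N\<close>.\<close>
  have diff_bound: "real (card (S N \<inter> ball 0 R)) - real (card (L \<inter> ball 0 R))
      \<le> real (card P) * (1 + C * (2 * R) ^ ?n * \<epsilon> N)" if R: "R \<ge> \<rho>" for N R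
  proof -
    let ?W = "(\<Union>m\<in>{N<..}. dilate (m ^ k) \<Lambda> - {0}) \<inter> ball (0::real^'n) (2 * R)"
    have finW: "finite ?W"
    proof -
      have "dilate m \<Lambda> \<subseteq> \<Lambda>" for m
        using lattice_basis_scale[OF A(1), of _ "real m"] by (auto simp: dilate_def)
      then show ?thesis
        by (intro finite_subset[OF _ finite_lattice_Int_ball[OF A(1), of "2*R"]]) auto
    qed
    have sub: "(S N - L) \<inter> ball 0 R \<subseteq> (\<Union>x\<in>P. (\<lambda>y. y - x) ` insert 0 ?W)"
    proof
      fix t assume t: "t \<in> (S N - L) \<inter> ball 0 R"
      then have "t \<in> \<Lambda>" by (auto simp: S_def sieved_set_def)
      with t have "t \<in> uminus ` P \<or> (\<exists>p. prime p \<and> (\<exists>x\<in>P. x + t \<in> dilate (p ^ k) \<Lambda>))"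
        unfolding L_def locator_set_empty[OF A(1) k(1) P(2)] by (auto simp: sieved_set_def)
      then have "\<exists>x\<in>P. x + t \<in> insert 0 ?W"
      proof
        assume "t \<in> uminus ` P" then show ?thesis by auto
      next
        assume "\<exists>p. prime p \<and> (\<exists>x\<in>P. x + t \<in> dilate (p ^ k) \<Lambda>)"
        then obtain p x where p: "prime p" "x \<in> P" "x + t \<in> dilate (p ^ k) \<Lambda>" by auto
        then have "p > N" using t by (auto simp: S_def sieved_set_def pr_def not_less)
        moreover have "norm (x + t) < 2 * R"
          using t \<rho>(1)[OF p(2)] R norm_triangle_ineq[of x t] by simp
        ultimately have "x + t \<in> insert 0 ?W" using p by auto
        then show ?thesis using p by blast
      qed
      then obtain x where "x \<in> P" "x + t \<in> insert 0 ?W" by blast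
      moreover have "t = (x + t) - x" by simp
      ultimately show "t \<in> (\<Union>x\<in>P. (\<lambda>y. y - x) ` insert 0 ?W)" by blast
    qed
    have "real (card (S N \<inter> ball 0 R)) - real (card (L \<inter> ball 0 R)) = real (card ((S N - L) \<inter> ball 0 R))"
    proof -
      have e: "(S N - L) \<inter> ball 0 R = S N \<inter> ball 0 R - L \<inter> ball 0 R" by auto
      have s: "L \<inter> ball 0 R \<subseteq> S N \<inter> ball 0 R" using LS by auto
      show ?thesis
        using finS card_mono[OF finS s] finite_subset[OF s finS]
        unfolding e by (simp add: card_Diff_subset[OF _ s] of_nat_diff)
    qed
    also have "\<dots> \<le> real (card (\<Union>x\<in>P. (\<lambda>y. y - x) ` insert 0 ?W))"
      using P finW by (intro of_nat_mono card_mono[OF _ sub]) auto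
    also have "\<dots> \<le> real (\<Sum>x\<in>P. card ((\<lambda>y. y - x) ` insert 0 ?W))"
      by (intro of_nat_mono card_UN_le P)
    also have "\<dots> \<le> real (\<Sum>x\<in>P. card (insert 0 ?W))"
      using finW by (intro of_nat_mono sum_mono card_image_le) auto
    also have "\<dots> \<le> real (card P) * (1 + real (card ?W))"
      using finW by (auto simp: card_insert_if algebra_simps)
    also have "\<dots> \<le> real (card P) * (1 + C * (2 * R) ^ ?n * \<epsilon> N)"
      using C(2)[of "2 * R" N] R \<rho> by (intro mult_left_mono) auto
    finally show ?thesis .
  qed
  have \<epsilon>0: "\<epsilon> \<longlonglongrightarrow> 0"
  proof -
    \<comment> \<open>The term at \<open>i = 0\<close> is \<open>1 / 0 = 0\<close>. Tails starting
      at \<open>N\<close> tend to 0, and \<open>LIMSEQ_Suc\<close> moves the start to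
      \<open>Suc N\<close>.\<close>
    have "summable (\<lambda>i. 1 / real i ^ 2)"
      using inverse_power_summable[of 2, where 'a=real] by (simp add: field_simps)
    then have "\<exists>M. \<forall>N\<ge>M. norm ((\<Sum>i. 1 / real (i + N) ^ 2) - 0) < r" if "r > 0" for r
      using suminf_exist_split[OF that] by (simp only: diff_zero)
    then have "(\<lambda>N. \<Sum>i. 1 / real (i + N) ^ 2) \<longlonglongrightarrow> 0"
      by (rule LIMSEQ_I)
    then show ?thesis unfolding \<epsilon>_def by (rule LIMSEQ_Suc)
  qed
  let ?D = "prodinf (euler_factor \<Lambda> k P)"
  let ?d = "\<lambda>N. \<Prod>p\<in>pr N. euler_factor \<Lambda> k P p"
  have lim: "?d \<longlonglongrightarrow> ?D"
  proof -
    \<comment> \<open>Factors at non-primes equal 1, so the product over primes up to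
      \<open>N\<close> is an ordinary partial product.\<close>
    have "?d N = (\<Prod>p\<le>N. euler_factor \<Lambda> k P p)" for N
      by (rule prod.mono_neutral_left) (auto simp: pr_def euler_factor_def)
    then show ?thesis
      using convergent_prod_LIMSEQ[OF convergent_prod_euler_factor[OF P(1) k(2)]] by simp
  qed
  let ?f = "\<lambda>Y R. real (card (Y \<inter> ball (0::real^'n) R)) / (R ^ ?n * v)"
  have "(?f L \<longlongrightarrow> ?D) at_top"
  proof (rule tendstoI)
    fix e :: real assume e: "e > 0"
    \<comment> \<open>This is the coefficient of \<open>\<epsilon> N\<close> in
      \<open>diff_bound\<close> after division by \<open>R ^ n * v\<close>. The total error splits
      into four quarters of \<open>e\<close>: this term, the tail of the product, the density error
      of \<open>S N\<close>, and the contribution of \<open>x + t = 0\<close>.\<close>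
    let ?c = "real (card P) * C * 2 ^ ?n / v"
    have "(\<lambda>N. ?c * \<epsilon> N) \<longlonglongrightarrow> 0" using tendsto_mult_left[OF \<epsilon>0, of ?c] by simp
    then have "\<forall>\<^sub>F N in sequentially. \<bar>?c * \<epsilon> N\<bar> < e / 4"
      using e by (auto dest!: tendstoD[of _ _ _ "e/4"])
    moreover have "\<forall>\<^sub>F N in sequentially. \<bar>?d N - ?D\<bar> < e / 4"
      using tendstoD[OF lim, of "e/4"] e by (simp add: dist_real_def)
    ultimately have "\<forall>\<^sub>F N in sequentially. \<bar>?c * \<epsilon> N\<bar> < e / 4 \<and> \<bar>?d N - ?D\<bar> < e / 4"
      by (rule eventually_conj)
    then obtain N where N: "\<bar>?c * \<epsilon> N\<bar> < e / 4" "\<bar>?d N - ?D\<bar> < e / 4"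
      by (metis (no_types, lifting) eventually_happens' sequentially_bot)
    have "has_density (S N) (?d N)"
      unfolding S_def by (intro has_density_sieved_set[OF A P]) (auto simp: pr_def)
    then have "\<forall>\<^sub>F R in at_top. \<bar>?f (S N) R - ?d N\<bar> < e / 4"
      using e by (auto simp: has_density_def v_def dist_real_def dest!: tendstoD[of _ _ _ "e/4"])
    moreover have "\<forall>\<^sub>F R in at_top. \<bar>real (card P) / (R ^ ?n * v)\<bar> < e / 4"
    proof -
      have "filterlim (\<lambda>R. R ^ ?n * v) at_top at_top"
        by (intro filterlim_at_top_mult_tendsto_pos[OF tendsto_const v] filterlim_pow_at_top filterlim_ident) auto
      then have "((\<lambda>R. real (card P) / (R ^ ?n * v)) \<longlongrightarrow> 0) at_top"
        by (intro tendsto_divide_0[OF tendsto_const] filterlim_at_top_imp_at_infinity)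
      then show ?thesis using e by (auto dest!: tendstoD[of _ _ _ "e/4"])
    qed
    ultimately show "\<forall>\<^sub>F R in at_top. dist (?f L R) ?D < e"
      using eventually_ge_at_top[of \<rho>]
    proof eventually_elim
      case (elim R)
      then have R: "R > 0" using \<rho> by linarith
      have pos: "R ^ ?n * v > 0" using R v by simp
      have "?f (S N) R - ?f L R = (real (card (S N \<inter> ball 0 R)) - real (card (L \<inter> ball 0 R))) / (R ^ ?n * v)"
        by (simp add: diff_divide_distrib)
      also have "\<dots> \<le> real (card P) * (1 + C * (2 * R) ^ ?n * \<epsilon> N) / (R ^ ?n * v)"
        using pos elim by (intro divide_right_mono diff_bound) auto
      also have "\<dots> = real (card P) / (R ^ ?n * v) + ?c * \<epsilon> N"
        using R v by (simp add: power_mult_distrib field_simps)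
      finally have "?f (S N) R - ?f L R \<le> real (card P) / (R ^ ?n * v) + ?c * \<epsilon> N" .
      moreover have "?f L R \<le> ?f (S N) R"
        using pos LS finS by (intro divide_right_mono of_nat_mono card_mono) auto
      ultimately show ?case using elim N unfolding dist_real_def by linarith
    qed
  qed
  then show ?thesis by (simp add: has_density_def v_def L_def)
qed

section \<open>Inclusion-exclusion over the excluded pattern\<close>

text \<open>Since \<open>q + t\<close> stays in the lattice, it lies either in \<open>V\<close> or
  in its complement. The first alternative amounts to moving \<open>q\<close> into
  \<open>P\<close>.\<close>

lemma locator_set_insert:
  assumes "lattice_basis A \<Lambda>" "q \<in> \<Lambda>"
  shows "locator_set \<Lambda> V P (insert q Q) = locator_set \<Lambda> V P Q - locator_set \<Lambda> V (insert q P) Q"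
  using assms lattice_basis_add[OF assms(1)] by (auto simp: locator_set_def)

text \<open>The induction keeps \<open>P\<close> arbitrary because its hypothesis is used for both
  \<open>P\<close> and \<open>insert q P\<close>.\<close>

lemma has_density_locator_set:
  fixes A :: "real^'n^'n"
  assumes A: "lattice_basis A \<Lambda>" "\<bar>det A\<bar> = 1" and k: "k \<ge> 1" "CARD('n) * k \<ge> 2"
    and Q: "finite Q" "Q \<subseteq> \<Lambda>" and P: "finite P" "P \<subseteq> \<Lambda>"
  shows "has_density (locator_set \<Lambda> (k_free_points \<Lambda> k) P Q)
      (\<Sum>F\<in>Pow Q. (- 1) ^ card F * prodinf (euler_factor \<Lambda> k (P \<union> F)))"
  using Q P
proof (induction Q arbitrary: P rule: finite_induct)
  case empty
  then show ?case using has_density_locator_set_empty[OF A k] by simp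
next
  case (insert q Q)
  let ?V = "k_free_points \<Lambda> k" and ?g = "\<lambda>F. prodinf (euler_factor \<Lambda> k F)"
  have fin: "finite (locator_set \<Lambda> ?V P Q \<inter> ball 0 R)" for R
    by (rule finite_subset[OF _ finite_lattice_Int_ball[OF A(1), of R]]) (auto simp: locator_set_def)
  have q: "q \<in> \<Lambda>" using insert.prems by simp
  have "has_density (locator_set \<Lambda> ?V P (insert q Q))
     ((\<Sum>F\<in>Pow Q. (- 1) ^ card F * ?g (P \<union> F)) - (\<Sum>F\<in>Pow Q. (- 1) ^ card F * ?g (insert q P \<union> F)))"
    unfolding locator_set_insert[OF A(1) q]
  proof (rule has_density_diff[OF _ fin])
    show "locator_set \<Lambda> ?V (insert q P) Q \<subseteq> locator_set \<Lambda> ?V P Q"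
      by (auto simp: locator_set_def)
  qed (use insert.prems in \<open>auto intro!: insert.IH simp del: Un_insert_left\<close>)
  moreover have "(\<Sum>F\<in>Pow (insert q Q). (- 1) ^ card F * ?g (P \<union> F))
    = (\<Sum>F\<in>Pow Q. (- 1) ^ card F * ?g (P \<union> F)) - (\<Sum>F\<in>Pow Q. (- 1) ^ card F * ?g (insert q P \<union> F))"
  proof -
    have inj: "inj_on (insert q) (Pow Q)" using insert.hyps by (auto simp: inj_on_def)
    \<comment> \<open>The subsets containing \<open>q\<close> give the subtracted sum: adding
      \<open>q\<close> to \<open>F\<close> flips the sign and can be read as adding \<open>q\<close>
      to \<open>P\<close>.\<close>
    have "(\<Sum>F\<in>insert q ` Pow Q. (- 1) ^ card F * ?g (P \<union> F))
      = (\<Sum>F\<in>Pow Q. - ((- 1) ^ card F * ?g (insert q P \<union> F)))"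
      unfolding sum.reindex[OF inj] comp_def
    proof (rule sum.cong)
      fix F assume "F \<in> Pow Q"
      then have "finite F" "q \<notin> F" using insert.hyps finite_subset by auto
      then show "(- 1) ^ card (insert q F) * ?g (P \<union> insert q F)
        = - ((- 1) ^ card F * ?g (insert q P \<union> F))" by simp
    qed simp
    then show ?thesis
      unfolding Pow_insert using insert.hyps
      by (subst sum.union_disjoint) (auto simp: sum_negf)
  qed
  ultimately show ?case by simp
qed

theorem theorem1:
  fixes \<Lambda> P Q V :: "(real^'n) set" and k :: nat
  assumes "is_lattice \<Lambda>" and "lattice_det \<Lambda> = 1"
    and "k \<ge> 1" and "CARD('n) = 1 \<longrightarrow> k \<ge> 2"
    and "V = k_free_points \<Lambda> k"
    and "finite P" and "P \<subseteq> \<Lambda>" and "finite Q" and "Q \<subseteq> \<Lambda>" and "P \<inter> Q = {}"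
  shows "(\<forall>F\<in>Pow Q. convergent_prod (euler_factor \<Lambda> k (P \<union> F))) \<and>
    has_density (locator_set \<Lambda> V P Q)
      (\<Sum>F\<in>Pow Q. (- 1) ^ card F * prodinf (euler_factor \<Lambda> k (P \<union> F)))"
proof -
  obtain A where A: "lattice_basis A \<Lambda>" using assms(1) by (auto simp: is_lattice_def)
  then have det: "\<bar>det A\<bar> = 1" using assms(2) lattice_det_eq by metis
  \<comment> \<open>The condition on \<open>k\<close> in dimension one becomes the exponent bound
    that makes the error series and the products converge.\<close>
  have nk: "CARD('n) * k \<ge> 2"
  proof (cases "CARD('n) = 1")
    case False
    moreover have "CARD('n) > 0" by simp
    ultimately have "CARD('n) \<ge> 2" by linarith
    then show ?thesis using mult_le_mono[of 2 "CARD('n)" 1 k] assms(3) by simp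
  qed (use assms(4) in simp)
  \<comment> \<open>Convergence ensures that each \<open>prodinf\<close> in the formula is the limit
    of its partial products and not an unspecified value.\<close>
  have "convergent_prod (euler_factor \<Lambda> k (P \<union> F))" if "F \<in> Pow Q" for F
    using that assms by (intro convergent_prod_euler_factor[OF _ nk]) (auto intro: finite_subset)
  then show ?thesis
    using has_density_locator_set[OF A det assms(3) nk assms(8,9,6,7)] assms(5) by blast
qed

end
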